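(* Let $\lambda>-1$ be real with $\lambda\neq 0$, and let $y\in\mathbb{R}$. The bivariate degenerate Hermite polynomials $H_n(x,y|\lambda)$, $n\ge 0$, are quasi-monomial (with respect to the variable $x$) with multiplicative and derivative operators $$\hat{\mathcal M}=\frac{\log(1+\lambda)}{\lambda}\,x+2y\,\partial_x,\qquad \hat{\mathcal P}=\frac{\lambda}{\log(1+\lambda)}\,\partial_x,$$ respectively.
   Context: The bivariate degenerate Hermite polynomials are $$H_n(x,y|\lambda)=\sum_{k=0}^{\lfloor n/2\rfloor}\frac{n!}{(n-2k)!\,k!}\left(\frac{\log(1+\lambda)}{\lambda}\right)^{n-k}x^{n-2k}y^k,$$ equivalently they are given by the generating function $(1+\lambda)^{(xt+yt^2)/\lambda}=\sum_{n\ge0}H_n(x,y|\lambda)\frac{t^n}{n!}$. Here $\log$ is the natural logarithm and $\partial_x$ is the partial derivative in $x$ with $y$ fixed. A family of polynomials $\{g_n(x)\}_{n\ge 0}$ is quasi-monomial with multiplicative operator $\hat{\mathcal M}$ and derivative operator $\hat{\mathcal P}$ (linear operators on polynomials in $x$) if, for all $n\ge0$, $\hat{\mathcal M}\{g_n(x)\}=g_{n+1}(x)$ and $\hat{\mathcal P}\{g_n(x)\}=n\,g_{n-1}(x)$ (the right-hand side being $0$ for $n=0$), along with the commutation relation $\hat{\mathcal P}\hat{\mathcal M}-\hat{\mathcal M}\hat{\mathcal P}=1$ (the identity operator). *)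

theory Defs
  imports Complex_Main "HOL-Computational_Algebra.Polynomial"
begin

(* The polynomial in x obtained from H_n(x,y|l) by fixing the real parameters y and l. *)
definition degen_hermite :: "nat \<Rightarrow> real \<Rightarrow> real \<Rightarrow> real poly" where
  "degen_hermite n y l =
     (\<Sum>k = 0..n div 2.
        monom (fact n / (fact (n - 2 * k) * fact k) * (ln (1 + l) / l) ^ (n - k) * y ^ k)
          (n - 2 * k))"

lemma poly_degen_hermite:
  "poly (degen_hermite n y l) x =
     (\<Sum>k = 0..n div 2.
        fact n / (fact (n - 2 * k) * fact k) * (ln (1 + l) / l) ^ (n - k) * x ^ (n - 2 * k) * y ^ k)"
  unfolding degen_hermite_def poly_sum
  by (intro sum.cong refl) (simp add: poly_monom mult_ac)

(* For n = 0 the term g (n - 1) is g 0 by truncated subtraction, but its factor is 0. *)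
definition quasi_monomial ::
  "(nat \<Rightarrow> real poly) \<Rightarrow> (real poly \<Rightarrow> real poly) \<Rightarrow> (real poly \<Rightarrow> real poly) \<Rightarrow> bool" where
  "quasi_monomial g M P \<longleftrightarrow>
     Vector_Spaces.linear smult smult M \<and>
     Vector_Spaces.linear smult smult P \<and>
     (\<forall>n. M (g n) = g (Suc n)) \<and>
     (\<forall>n. P (g n) = smult (of_nat n) (g (n - 1))) \<and>
     (\<forall>p. P (M p) - M (P p) = p)"

end

theory Submission
  imports Defs
begin

text \<open>
  Write \<open>c = ln (1 + \<lambda>) / \<lambda>\<close>, which is nonzero. The coefficient of \<open>x\<^sup>m\<close> in \<open>H\<^sub>n\<close>
  vanishes unless \<open>n = m + 2 k\<close>, and then it is \<open>n! / (m! k!) * c\<^bsup>m + k\<^esup> * y\<^bsup>k\<^esup>\<close>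
  (lemmas \<open>coeff_degen_hermite\<close> and \<open>coeff_degen_hermite_eq_0\<close>); in the variables \<open>m\<close> and \<open>k\<close> no
  subtraction is left. Comparing coefficients, the lowering relation comes down to
  \<open>(m + 1) / (m + 1)! = 1 / m!\<close> and \<open>n! = n (n - 1)!\<close>, with one power of \<open>c\<close> left over. In the raising relation, the terms \<open>c x H\<^sub>n\<close> and \<open>2 y \<partial>\<^sub>x H\<^sub>n\<close>
  contribute the shares \<open>m / (n + 1)\<close> and \<open>2 k / (n + 1)\<close> of the coefficient of
  \<open>x\<^sup>m\<close> in \<open>H\<^bsub>n+1\<^esub>\<close>, where \<open>n + 1 = m + 2 k\<close>. The commutation
  relation does not involve the family: \<open>\<partial>\<^sub>x\<close> commutes with itself, so the Leibniz rule leaves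
  \<open>c\<^sup>-\<^sup>1 c (\<partial>\<^sub>x x - x \<partial>\<^sub>x) = 1\<close>.
\<close>

lemma coeff_degen_hermite:
  "coeff (degen_hermite (m + 2 * k) y l) m =
     fact (m + 2 * k) / (fact m * fact k) * (ln (1 + l) / l) ^ (m + k) * y ^ k"
proof -
  let ?a = "\<lambda>j. fact (m + 2 * k) / (fact (m + 2 * k - 2 * j) * fact j)
                * (ln (1 + l) / l) ^ (m + 2 * k - j) * y ^ j"
  have "coeff (degen_hermite (m + 2 * k) y l) m =
        (\<Sum>j = 0..(m + 2 * k) div 2. if j = k then ?a j else 0)"
    unfolding degen_hermite_def coeff_sum by (intro sum.cong) auto
  also have "\<dots> = ?a k"
    by simp
  also have "m + 2 * k - k = m + k"
    by simp
  finally show ?thesis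
    by simp
qed

lemma coeff_degen_hermite_eq_0:
  assumes "\<And>k. n \<noteq> m + 2 * k"
  shows "coeff (degen_hermite n y l) m = 0"
proof -
  have "n - 2 * k \<noteq> m" if "k \<le> n div 2" for k
    using assms[of k] that by auto
  then show ?thesis
    unfolding degen_hermite_def coeff_sum by (intro sum.neutral) auto
qed

lemma pderiv_degen_hermite:
  "pderiv (degen_hermite n y l) =
     smult (ln (1 + l) / l * of_nat n) (degen_hermite (n - 1) y l)"
proof (cases n)
  case 0
  then show ?thesis
    by (simp add: degen_hermite_def pderiv_monom)
next
  case (Suc i)
  define c where "c = ln (1 + l) / l"
  have "pderiv (degen_hermite n y l) = smult (c * of_nat n) (degen_hermite (n - 1) y l)"
  proof (rule poly_eqI)
    fix m
    show "coeff (pderiv (degen_hermite n y l)) m =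
          coeff (smult (c * of_nat n) (degen_hermite (n - 1) y l)) m"
    proof (cases "\<exists>k. i = m + 2 * k")
      case True
      then obtain k where i: "i = m + 2 * k" ..
      then have n: "n = Suc m + 2 * k"
        using Suc by simp
      have "coeff (degen_hermite n y l) (Suc m) =
            fact n / (fact (Suc m) * fact k) * c ^ (Suc m + k) * y ^ k"
        using coeff_degen_hermite[of "Suc m" k y l] unfolding n c_def .
      moreover have "coeff (degen_hermite i y l) m =
            fact i / (fact m * fact k) * c ^ (m + k) * y ^ k"
        using coeff_degen_hermite[of m k y l] unfolding i c_def .
      ultimately show ?thesis
        using Suc by (simp add: coeff_pderiv del: of_nat_Suc)
    next
      case False
      then show ?thesis
        using Suc by (simp add: coeff_pderiv coeff_degen_hermite_eq_0)
    qed
  qed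
  then show ?thesis
    unfolding c_def .
qed

text \<open>
  The case distinctions in this proof separate the boundary terms: multiplication by \<open>x\<close> reaches no
  constant coefficient (\<open>m = 0\<close>), and differentiation does not reach the leading one (\<open>k = 0\<close>).
\<close>

lemma degen_hermite_Suc:
  "degen_hermite (Suc n) y l =
     smult (ln (1 + l) / l) ([:0, 1:] * degen_hermite n y l)
     + smult (2 * y) (pderiv (degen_hermite n y l))"
proof (rule poly_eqI)
  fix m
  define c where "c = ln (1 + l) / l"
  let ?h = "\<lambda>n. coeff (degen_hermite n y l)"
  let ?x = "\<lambda>m. case m of 0 \<Rightarrow> 0 | Suc j \<Rightarrow> ?h n j"
  have "?h (Suc n) m = c * ?x m + 2 * y * (of_nat (Suc m) * ?h n (Suc m))"
  proof (cases "\<exists>k. Suc n = m + 2 * k")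
    case True
    then obtain k where n: "Suc n = m + 2 * k" ..
    define w where "w = fact n / (fact m * fact k) * c ^ (m + k) * y ^ k"
    have "?h (Suc n) m = of_nat (Suc n) * w"
      using coeff_degen_hermite[of m k y l] unfolding n[symmetric] w_def c_def by simp
    moreover have "c * ?x m = of_nat m * w"
    proof (cases m)
      case (Suc j)
      then have n': "n = j + 2 * k"
        using n by simp
      have "?h n j = fact n / (fact j * fact k) * c ^ (j + k) * y ^ k"
        using coeff_degen_hermite[of j k y l] unfolding n' c_def .
      then show ?thesis
        using Suc by (simp add: w_def del: of_nat_Suc)
    qed simp
    moreover have "2 * y * (of_nat (Suc m) * ?h n (Suc m)) = 2 * of_nat k * w"
    proof (cases k)
      case 0
      then have "?h n (Suc m) = 0"
        using n by (intro coeff_degen_hermite_eq_0) auto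
      then show ?thesis
        using 0 by simp
    next
      case (Suc j)
      then have n': "n = Suc m + 2 * j"
        using n by simp
      have "?h n (Suc m) = fact n / (fact (Suc m) * fact j) * c ^ (Suc m + j) * y ^ j"
        using coeff_degen_hermite[of "Suc m" j y l] unfolding n' c_def .
      then show ?thesis
        using Suc by (simp add: w_def del: of_nat_Suc)
    qed
    moreover have "of_nat (Suc n) * w = of_nat m * w + 2 * of_nat k * w"
      unfolding n by (simp add: distrib_right)
    ultimately show ?thesis
      by simp
  next
    case False
    have "?h (Suc n) m = 0"
      using False by (intro coeff_degen_hermite_eq_0) blast
    moreover have "?h n (Suc m) = 0"
    proof (rule coeff_degen_hermite_eq_0)
      show "n \<noteq> Suc m + 2 * k" for k
        using False by (auto dest: spec[of _ "Suc k"])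
    qed
    moreover have "?x m = 0"
      using False by (auto split: nat.split intro!: coeff_degen_hermite_eq_0)
    ultimately show ?thesis
      by simp
  qed
  then show "?h (Suc n) m =
      coeff (smult (ln (1 + l) / l) ([:0, 1:] * degen_hermite n y l)
             + smult (2 * y) (pderiv (degen_hermite n y l))) m"
    by (simp add: c_def coeff_pderiv coeff_pCons del: of_nat_Suc split: nat.split)
qed

theorem theorem5:
  fixes l y :: real
  assumes "l > -1" and "l \<noteq> 0"
  shows "quasi_monomial (\<lambda>n. degen_hermite n y l)
           (\<lambda>p. smult (ln (1 + l) / l) ([:0, 1:] * p) + smult (2 * y) (pderiv p))
           (\<lambda>p. smult (l / ln (1 + l)) (pderiv p))"
proof -
  have ln: "ln (1 + l) \<noteq> 0"
    using assms by simp
  have vs: "vector_space (smult :: real \<Rightarrow> real poly \<Rightarrow> real poly)"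
    by unfold_locales (simp_all add: smult_add_right smult_add_left)
  have linearI: "Vector_Spaces.linear smult smult f"
    if "\<And>p q. f (p + q) = f p + f q" and "\<And>a p. f (smult a p) = smult a (f p)"
    for f :: "real poly \<Rightarrow> real poly"
    using vs that by (simp add: Vector_Spaces.linear_iff)
  show ?thesis
    unfolding quasi_monomial_def
  proof (intro conjI allI)
    show "Vector_Spaces.linear smult smult
        (\<lambda>p. smult (ln (1 + l) / l) ([:0, 1:] * p) + smult (2 * y) (pderiv p))"
      by (rule linearI) (simp_all add: pderiv_add pderiv_smult smult_add_right mult_ac)
    show "Vector_Spaces.linear smult smult (\<lambda>p. smult (l / ln (1 + l)) (pderiv p))"
      by (rule linearI) (simp_all add: pderiv_add pderiv_smult smult_add_right mult_ac)
  next
    fix n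
    show "smult (ln (1 + l) / l) ([:0, 1:] * degen_hermite n y l)
        + smult (2 * y) (pderiv (degen_hermite n y l)) = degen_hermite (Suc n) y l"
      by (rule degen_hermite_Suc[symmetric])
    show "smult (l / ln (1 + l)) (pderiv (degen_hermite n y l)) =
        smult (of_nat n) (degen_hermite (n - 1) y l)"
      using ln assms(2) by (simp add: pderiv_degen_hermite)
  next
    fix p :: "real poly"
    show "smult (l / ln (1 + l))
          (pderiv (smult (ln (1 + l) / l) ([:0, 1:] * p) + smult (2 * y) (pderiv p)))
        - (smult (ln (1 + l) / l) ([:0, 1:] * smult (l / ln (1 + l)) (pderiv p))
           + smult (2 * y) (pderiv (smult (l / ln (1 + l)) (pderiv p)))) = p"
      using ln assms(2)
      by (simp add: pderiv_add pderiv_smult pderiv_pCons smult_add_right mult_ac)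
  qed
qed

end
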